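(* Let $U$ be a non-principal ultrafilter over $\omega$, and let $(P_i : i\in\omega)$ be the sequence of finite posets defined in the context. Then the ultraproduct $\prod_U P_i$ is $\omega$-representable.
   Context: Representability: let $\alpha,\beta$ be cardinals. A poset $P$ is $(\alpha,\beta)$-representable if there is a field of sets $F$ (a family of subsets of some set $X$ closed under finite unions, finite intersections and complements in $X$) and a one-to-one map $h:P\to F$ such that: (1) whenever $S\subseteq P$ with $|S|<\alpha$ and $\bigwedge S$ exists in $P$, then $h(\bigwedge S)=\bigcap h[S]$; (2) whenever $T\subseteq P$ with $|T|<\beta$ and $\bigvee T$ exists in $P$, then $h(\bigvee T)=\bigcup h[T]$. "$\alpha$-representable" means $(\alpha,\alpha)$-representable. The posets $P_k$: define sets $N_n$ ($n\in\omega$) recursively by $N_0=\{a,b,c,d\}$ (four distinct elements) and $N_{n+1}=\{e_{xy}: x,y \text{ distinct elements of } N_n\}$, with one element $e_{xy}=e_{yx}$ for each unordered pair of distinct elements of $N_n$. Let $\widehat N_n=\bigcup_{x\in N_n}\{x',x''\}$, where $x',x''$ are two new elements for each $x$. Differently labeled elements are distinct. For $k\in\omega$, the carrier of $P_k$ is $\{p,q\}\cup\bigcup_{n=0}^k N_n\cup\bigcup_{n=0}^k\widehat N_n$, and its order is: (1) $x<p$ for all $x\in N_0$; (2) $x<x'$ and $x<x''$ for all $x\in N_n$, $n\le k$; (3) for $1\le n\le k$ and distinct $x,y\in N_{n-1}$, $e_{xy}<x'$, $e_{xy}<x''$, $e_{xy}<y'$, $e_{xy}<y''$; (4) $q<x'$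 and $q<x''$ for all $x\in N_k$; (5) $x\le x$ for all $x\in P_k$; (6) no other elements are comparable. *)

theory Defs
  imports
    "HOL-Algebra.Order"
    "HOL-Analysis.Sigma_Algebra"
    "HOL-Library.Uprod"
begin

unbundle cardinal_syntax

section \<open>Representability\<close>

text \<open>Cardinals are cardinal order relations in the sense of \<^const>\<open>card_order_on\<close>; the cardinal
  \<open>\<omega>\<close> is \<^const>\<open>natLeq\<close>. A field of sets on \<open>X\<close> is an \<^const>\<open>algebra\<close> on \<open>X\<close>. The intersection of
  the empty family of subsets of \<open>X\<close> is \<open>X\<close>, whence the term \<open>X \<inter> \<Inter> (h ` S)\<close>.\<close>

definition representation ::
    "'c rel \<Rightarrow> 'd rel \<Rightarrow> ('a, 'm) gorder_scheme \<Rightarrow> 'x set \<Rightarrow> 'x set set \<Rightarrow> ('a \<Rightarrow> 'x set) \<Rightarrow> bool"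
  where "representation \<alpha> \<beta> L X F h \<longleftrightarrow>
    algebra X F \<and> h \<in> carrier L \<rightarrow> F \<and> inj_on h (carrier L) \<and>
    (\<forall>S m. S \<subseteq> carrier L \<and> |S| <o \<alpha> \<and> is_glb L m S \<longrightarrow> h m = X \<inter> \<Inter> (h ` S)) \<and>
    (\<forall>T j. T \<subseteq> carrier L \<and> |T| <o \<beta> \<and> is_lub L j T \<longrightarrow> h j = \<Union> (h ` T))"

text \<open>A definition cannot quantify over the type of the points of \<open>X\<close>. Taking sets of elements of
  the poset as points is no restriction, by the lemma following the definition.\<close>

definition representable :: "'c rel \<Rightarrow> 'd rel \<Rightarrow> ('a, 'm) gorder_scheme \<Rightarrow> bool"
  where "representable \<alpha> \<beta> L \<longleftrightarrow>
    (\<exists>(X :: 'a set set) F h. representation \<alpha> \<beta> L X F h)"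

lemma representation_imp_representable:
  fixes X :: "'x set" and L :: "('a, 'm) gorder_scheme"
  assumes "representation \<alpha> \<beta> L X F h"
  shows "representable \<alpha> \<beta> L"
proof -
  define t where "t x = {a \<in> carrier L. x \<in> h a}" for x
  define Y where "Y = t ` X"
  define g where "g a = {G \<in> Y. a \<in> G}" for a
  have sub: "h a \<subseteq> X" if "a \<in> carrier L" for a
    using assms that algebra_iff_Un[of X F] unfolding representation_def by blast
  have g_iff: "t x \<in> g a \<longleftrightarrow> x \<in> h a" if "a \<in> carrier L" "x \<in> X" for a x
    using that unfolding g_def Y_def t_def by auto
  have g_Y: "g a \<subseteq> t ` X" for a
    unfolding g_def Y_def by auto
  have "inj_on g (carrier L)"
  proof (rule inj_onI)
    fix a b assume ab: "a \<in> carrier L" "b \<in> carrier L" "g a = g b"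
    have "x \<in> h a \<longleftrightarrow> x \<in> h b" if "x \<in> X" for x
      using g_iff[OF ab(1) that] g_iff[OF ab(2) that] ab(3) by simp
    then have "h a = h b"
      using sub[OF ab(1)] sub[OF ab(2)] by (metis subsetD subsetI subset_antisym)
    with ab show "a = b"
      using assms by (simp add: representation_def inj_on_def)
  qed
  moreover have "g m = Y \<inter> \<Inter> (g ` S)"
    if S: "S \<subseteq> carrier L" "|S| <o \<alpha>" and m: "is_glb L m S" for S m
  proof -
    have mL: "m \<in> carrier L"
      using m by (auto simp: greatest_def Lower_def)
    have hm: "h m = X \<inter> \<Inter> (h ` S)"
      using assms S m unfolding representation_def by blast
    have "t x \<in> g m \<longleftrightarrow> t x \<in> \<Inter> (g ` S)" if "x \<in> X" for x
    proof -
      have "t x \<in> g a \<longleftrightarrow> x \<in> h a" if "a \<in> S" for a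
        using g_iff[OF _ \<open>x \<in> X\<close>] S that by blast
      then show ?thesis
        using g_iff[OF mL that] hm that by simp
    qed
    then show ?thesis
      using g_Y[of m] unfolding Y_def by blast
  qed
  moreover have "g j = \<Union> (g ` T)"
    if T: "T \<subseteq> carrier L" "|T| <o \<beta>" and j: "is_lub L j T" for T j
  proof -
    have jL: "j \<in> carrier L"
      using j by (auto simp: least_def Upper_def)
    have hj: "h j = \<Union> (h ` T)"
      using assms T j unfolding representation_def by blast
    have "t x \<in> g j \<longleftrightarrow> t x \<in> \<Union> (g ` T)" if "x \<in> X" for x
    proof -
      have "t x \<in> g a \<longleftrightarrow> x \<in> h a" if "a \<in> T" for a
        using g_iff[OF _ \<open>x \<in> X\<close>] T that by blast
      then show ?thesis
        using g_iff[OF jL that] hj by simp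
    qed
    then show ?thesis
      using g_Y unfolding Y_def by blast
  qed
  moreover have "g \<in> carrier L \<rightarrow> Pow Y"
    unfolding g_def by auto
  ultimately have "representation \<alpha> \<beta> L Y (Pow Y) g"
    unfolding representation_def by (intro conjI allI impI) (simp_all add: algebra_Pow)
  then show ?thesis
    unfolding representable_def by blast
qed


section \<open>Ultraproducts\<close>

definition ultrafilter :: "'i filter \<Rightarrow> bool"
  where "ultrafilter U \<longleftrightarrow>
    U \<noteq> bot \<and> (\<forall>Q. eventually Q U \<or> eventually (\<lambda>i. \<not> Q i) U)"

definition nonprincipal :: "'i filter \<Rightarrow> bool"
  where "nonprincipal U \<longleftrightarrow> (\<nexists>S. U = principal S)"

definition ultra_rel :: "'i filter \<Rightarrow> ('i \<Rightarrow> ('a, 'm) gorder_scheme) \<Rightarrow> ('i \<Rightarrow> 'a) rel"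
  where "ultra_rel U L =
    {(f, g). (\<forall>i. f i \<in> carrier (L i)) \<and> (\<forall>i. g i \<in> carrier (L i)) \<and> (\<forall>\<^sub>F i in U. f i = g i)}"

definition ultraproduct :: "'i filter \<Rightarrow> ('i \<Rightarrow> ('a, 'm) gorder_scheme) \<Rightarrow> ('i \<Rightarrow> 'a) set gorder"
  where "ultraproduct U L =
    \<lparr>carrier = {f. \<forall>i. f i \<in> carrier (L i)} // ultra_rel U L,
     eq = (=),
     le = (\<lambda>C D. \<exists>f\<in>C. \<exists>g\<in>D. \<forall>\<^sub>F i in U. f i \<sqsubseteq>\<^bsub>L i\<^esub> g i)\<rparr>"

lemma equiv_ultra_rel: "equiv {f. \<forall>i. f i \<in> carrier (L i)} (ultra_rel U L)"
proof (rule equivI)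
  show "ultra_rel U L \<subseteq> {f. \<forall>i. f i \<in> carrier (L i)} \<times> {f. \<forall>i. f i \<in> carrier (L i)}"
    unfolding ultra_rel_def by auto
  show "refl_on {f. \<forall>i. f i \<in> carrier (L i)} (ultra_rel U L)"
    unfolding ultra_rel_def refl_on_def by auto
  show "sym (ultra_rel U L)"
    unfolding ultra_rel_def sym_def by (auto elim: eventually_mono)
  show "trans (ultra_rel U L)"
    unfolding ultra_rel_def by (intro transI) (auto elim: eventually_elim2)
qed

lemma ultraproduct_le_iff:
  assumes "\<And>i. f i \<in> carrier (L i)" "\<And>i. g i \<in> carrier (L i)"
  shows "ultra_rel U L `` {f} \<sqsubseteq>\<^bsub>ultraproduct U L\<^esub> ultra_rel U L `` {g} \<longleftrightarrow>
    (\<forall>\<^sub>F i in U. f i \<sqsubseteq>\<^bsub>L i\<^esub> g i)" (is "?l \<longleftrightarrow> ?r")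
proof
  assume ?l
  then obtain f' g' where "\<forall>\<^sub>F i in U. f i = f' i" "\<forall>\<^sub>F i in U. g i = g' i"
      "\<forall>\<^sub>F i in U. f' i \<sqsubseteq>\<^bsub>L i\<^esub> g' i"
    unfolding ultraproduct_def ultra_rel_def by auto
  then show ?r
    by eventually_elim simp
next
  assume ?r
  moreover have "f \<in> ultra_rel U L `` {f}" "g \<in> ultra_rel U L `` {g}"
    using assms unfolding ultra_rel_def by auto
  ultimately show ?l
    unfolding ultraproduct_def by auto
qed

lemma partial_order_ultraproduct:
  assumes "\<And>i. partial_order (L i)"
  shows "partial_order (ultraproduct U L)"
proof -
  let ?P = "ultraproduct U L"
  have rep: "\<exists>f. (\<forall>i. f i \<in> carrier (L i)) \<and> C = ultra_rel U L `` {f}"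
    if "C \<in> carrier ?P" for C
    using that unfolding ultraproduct_def by (auto elim!: quotientE)
  note wpo = partial_order.axioms(1)[OF assms]
  have eq: "(.=\<^bsub>?P\<^esub>) = (=)"
    unfolding ultraproduct_def by simp
  show ?thesis
  proof (unfold_locales; (unfold eq)?)
    fix C assume "C \<in> carrier ?P"
    then obtain f where "\<And>i. f i \<in> carrier (L i)" "C = ultra_rel U L `` {f}"
      using rep by blast
    then show "C \<sqsubseteq>\<^bsub>?P\<^esub> C"
      by (simp add: ultraproduct_le_iff weak_partial_order.le_refl[OF wpo])
  next
    fix C D assume le: "C \<sqsubseteq>\<^bsub>?P\<^esub> D" "D \<sqsubseteq>\<^bsub>?P\<^esub> C" and "C \<in> carrier ?P" "D \<in> carrier ?P"
    then obtain f g where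
      f: "\<And>i. f i \<in> carrier (L i)" "C = ultra_rel U L `` {f}" and
      g: "\<And>i. g i \<in> carrier (L i)" "D = ultra_rel U L `` {g}"
      using rep by meson
    have "\<forall>\<^sub>F i in U. f i \<sqsubseteq>\<^bsub>L i\<^esub> g i" "\<forall>\<^sub>F i in U. g i \<sqsubseteq>\<^bsub>L i\<^esub> f i"
      using le f g by (simp_all add: ultraproduct_le_iff)
    then have "\<forall>\<^sub>F i in U. f i = g i"
      by eventually_elim (auto intro: partial_order.le_antisym[OF assms] f g)
    then have "(f, g) \<in> ultra_rel U L"
      using f g unfolding ultra_rel_def by auto
    then show "C = D"
      using f g equiv_class_eq[OF equiv_ultra_rel] by blast
  next
    fix C D E assume le: "C \<sqsubseteq>\<^bsub>?P\<^esub> D" "D \<sqsubseteq>\<^bsub>?P\<^esub> E"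
      and "C \<in> carrier ?P" "D \<in> carrier ?P" "E \<in> carrier ?P"
    then obtain f g k where
      f: "\<And>i. f i \<in> carrier (L i)" "C = ultra_rel U L `` {f}" and
      g: "\<And>i. g i \<in> carrier (L i)" "D = ultra_rel U L `` {g}" and
      k: "\<And>i. k i \<in> carrier (L i)" "E = ultra_rel U L `` {k}"
      using rep by meson
    have "\<forall>\<^sub>F i in U. f i \<sqsubseteq>\<^bsub>L i\<^esub> g i" "\<forall>\<^sub>F i in U. g i \<sqsubseteq>\<^bsub>L i\<^esub> k i"
      using le f g k by (simp_all add: ultraproduct_le_iff)
    then have "\<forall>\<^sub>F i in U. f i \<sqsubseteq>\<^bsub>L i\<^esub> k i"
      by eventually_elim (rule weak_partial_order.le_trans[OF wpo]; (assumption | rule f g k))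
    then show "C \<sqsubseteq>\<^bsub>?P\<^esub> E"
      using f k by (simp add: ultraproduct_le_iff)
  qed auto
qed


section \<open>The posets \<open>P\<^sub>k\<close>\<close>

text \<open>\<open>NE (Upair x y)\<close> is \<open>e\<^sub>x\<^sub>y\<close>; \<open>Pr1 x\<close> and \<open>Pr2 x\<close> are \<open>x'\<close> and \<open>x''\<close>.\<close>

datatype node = NA | NB | NC | ND | NE "node uprod"

datatype elt = Elt_p | Elt_q | Nd node | Pr1 node | Pr2 node

fun Nn :: "nat \<Rightarrow> node set" where
  "Nn 0 = {NA, NB, NC, ND}"
| "Nn (Suc n) = {NE (Upair x y) | x y. x \<in> Nn n \<and> y \<in> Nn n \<and> x \<noteq> y}"

definition Nhat :: "nat \<Rightarrow> elt set"
  where "Nhat n = (\<Union>x\<in>Nn n. {Pr1 x, Pr2 x})"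

inductive P_less :: "nat \<Rightarrow> elt \<Rightarrow> elt \<Rightarrow> bool" for k where
  "x \<in> Nn 0 \<Longrightarrow> P_less k (Nd x) Elt_p"
| "n \<le> k \<Longrightarrow> x \<in> Nn n \<Longrightarrow> z \<in> {Pr1 x, Pr2 x} \<Longrightarrow> P_less k (Nd x) z"
| "1 \<le> n \<Longrightarrow> n \<le> k \<Longrightarrow> x \<in> Nn (n - 1) \<Longrightarrow> y \<in> Nn (n - 1) \<Longrightarrow> x \<noteq> y \<Longrightarrow>
    z \<in> {Pr1 x, Pr2 x, Pr1 y, Pr2 y} \<Longrightarrow> P_less k (Nd (NE (Upair x y))) z"
| "x \<in> Nn k \<Longrightarrow> z \<in> {Pr1 x, Pr2 x} \<Longrightarrow> P_less k Elt_q z"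

definition Pk :: "nat \<Rightarrow> elt gorder"
  where "Pk k =
    \<lparr>carrier = {Elt_p, Elt_q} \<union> (\<Union>n\<le>k. Nd ` Nn n) \<union> (\<Union>n\<le>k. Nhat n),
     eq = (=),
     le = (\<lambda>x y. P_less k x y \<or> x = y)\<rparr>"

lemma partial_order_P: "partial_order (Pk k)"
  by unfold_locales (auto simp: Pk_def elim: P_less.cases)

lemma finite_N: "finite (Nn n)"
proof (induction n)
  case (Suc n)
  have "Nn (Suc n) \<subseteq> (\<lambda>(x, y). NE (Upair x y)) ` (Nn n \<times> Nn n)"
    by auto
  then show ?case
    using Suc by (meson finite_SigmaI finite_imageI finite_subset)
qed simp

lemma finite_carrier_P: "finite (carrier (Pk k))"
  by (auto simp: Pk_def Nhat_def finite_N)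

end

theory Submission
  imports Defs
begin

text \<open>The points of the representation are the sets of elements of the ultraproduct that respect all
  existing finite meets and joins. In \<open>P\<^sub>k\<close> only \<open>p\<close> is the join of a set not containing it, and
  such a set consists of at least two elements of \<open>N\<^sub>0\<close>. Hence the up-set of every element outside
  \<open>N\<^sub>0 \<union> {p}\<close> is a point, as it does not contain \<open>p\<close>. To separate
  \<open>y \<in> N\<^sub>0\<close> from the other elements of \<open>N\<^sub>0 \<union> {p}\<close>, close \<open>p\<close> and the three elements of
  \<open>N\<^sub>0 - {y}\<close> under upper bounds and meets. In \<open>P\<^sub>k\<close> this process climbs one level per step, and
  after \<open>k\<close> steps it reaches \<open>q\<close> and collapses; in the ultraproduct the levels reached in finitely
  many steps stay below the infinite top level, and their union is a point.\<close>

section \<open>Representations by prime filters\<close>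

text \<open>Membership in \<open>G\<close> is a two-valued homomorphism on all existing finite meets
  and joins. The empty set is included, so a greatest element must lie in \<open>G\<close> and a
  least one must not.\<close>

definition prime_filter :: "('a, 'm) gorder_scheme \<Rightarrow> 'a set \<Rightarrow> bool"
  where "prime_filter L G \<longleftrightarrow>
    (\<forall>S m. finite S \<and> S \<subseteq> carrier L \<and> is_glb L m S \<longrightarrow> (m \<in> G \<longleftrightarrow> S \<subseteq> G)) \<and>
    (\<forall>T j. finite T \<and> T \<subseteq> carrier L \<and> is_lub L j T \<longrightarrow> (j \<in> G \<longleftrightarrow> T \<inter> G \<noteq> {}))"

text \<open>Each element goes to the set of prime filters containing it, inside the full power set.
  The two clauses of \<open>prime_filter\<close> turn meets into intersections and joins into
  unions; injectivity is the separation hypothesis.\<close>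

lemma representable_if_prime_filters_separate:
  assumes "\<And>u v. u \<in> carrier L \<Longrightarrow> v \<in> carrier L \<Longrightarrow> u \<noteq> v \<Longrightarrow>
    \<exists>G. prime_filter L G \<and> (u \<in> G \<longleftrightarrow> v \<notin> G)"
  shows "representable natLeq natLeq L"
proof -
  define X where "X = {G. prime_filter L G}"
  define h where "h a = {G \<in> X. a \<in> G}" for a
  have "inj_on h (carrier L)"
  proof (rule inj_onI, rule ccontr)
    fix u v assume "u \<in> carrier L" "v \<in> carrier L" "h u = h v" "u \<noteq> v"
    then show False
      using assms unfolding h_def X_def by blast
  qed
  moreover have "h m = X \<inter> \<Inter> (h ` S)"
    if "finite S" "S \<subseteq> carrier L" "is_glb L m S" for S m
    using that unfolding h_def X_def prime_filter_def by blast
  moreover have "h j = \<Union> (h ` T)"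
    if "finite T" "T \<subseteq> carrier L" "is_lub L j T" for T j
    using that unfolding h_def X_def prime_filter_def by blast
  moreover have "h \<in> carrier L \<rightarrow> Pow X"
    by (auto simp: h_def)
  ultimately have "representation natLeq natLeq L X (Pow X) h"
    unfolding representation_def
    by (simp add: algebra_Pow flip: finite_iff_ordLess_natLeq)
  then show ?thesis
    unfolding representable_def by blast
qed


section \<open>Ultraproducts\<close>

lemma ultrafilter_eventually_not:
  "ultrafilter U \<Longrightarrow> \<not> eventually Q U \<Longrightarrow> \<forall>\<^sub>F i in U. \<not> Q i"
  by (auto simp: ultrafilter_def)

text \<open>Otherwise each of the finitely many complements is large, hence so is their
  intersection. This makes a witness that varies with the index constant.\<close>

lemma ultrafilter_eventually_bex_finite:
  assumes "ultrafilter U" "finite A" "\<forall>\<^sub>F i in U. \<exists>x\<in>A. Q x i"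
  shows "\<exists>x\<in>A. \<forall>\<^sub>F i in U. Q x i"
proof (rule ccontr)
  assume "\<not> ?thesis"
  then have "\<forall>x\<in>A. \<forall>\<^sub>F i in U. \<not> Q x i"
    using ultrafilter_eventually_not[OF assms(1)] by blast
  then have "\<forall>\<^sub>F i in U. \<forall>x\<in>A. \<not> Q x i"
    using \<open>finite A\<close> by (simp add: eventually_ball_finite)
  with assms(3) have "\<forall>\<^sub>F i in U. False"
    by eventually_elim blast
  with assms(1) show False
    by (simp add: ultrafilter_def)
qed

text \<open>If the finite set \<open>A\<close> were large, one of its points would be, and
  \<open>U\<close> would be the principal filter at that point.\<close>

lemma nonprincipal_eventually_notin_finite:
  assumes "ultrafilter U" "nonprincipal U" "finite A"
  shows "\<forall>\<^sub>F i in U. i \<notin> A"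
proof (rule ccontr)
  assume "\<not> ?thesis"
  then have "\<forall>\<^sub>F i in U. \<exists>x\<in>A. i = x"
    using ultrafilter_eventually_not[OF assms(1)] by fastforce
  then obtain x where x: "\<forall>\<^sub>F i in U. i = x"
    using ultrafilter_eventually_bex_finite[OF assms(1,3), of "\<lambda>x i. i = x"] by blast
  have "eventually Q U \<longleftrightarrow> Q x" for Q
  proof
    assume "eventually Q U"
    with x have "\<forall>\<^sub>F i in U. Q x"
      by eventually_elim simp
    then show "Q x"
      using assms(1) by (auto simp: ultrafilter_def eventually_const_iff)
  next
    assume "Q x"
    with x show "eventually Q U"
      by (auto elim: eventually_mono)
  qed
  then have "U = principal {x}"
    by (simp add: filter_eq_iff eventually_principal)
  with assms(2) show False
    by (auto simp: nonprincipal_def)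
qed

section \<open>Finite meets and joins in an ultraproduct, read off in the factors\<close>

lemma ultraproduct_carrier_iff:
  "C \<in> carrier (ultraproduct U L) \<longleftrightarrow>
    (\<exists>f. (\<forall>i. f i \<in> carrier (L i)) \<and> C = ultra_rel U L `` {f})"
  unfolding ultraproduct_def by (auto simp: quotient_def)

lemma ultraproduct_classI:
  "(\<And>i. f i \<in> carrier (L i)) \<Longrightarrow> ultra_rel U L `` {f} \<in> carrier (ultraproduct U L)"
  by (auto simp: ultraproduct_carrier_iff)

lemma ultraproduct_representatives:
  assumes "S \<subseteq> carrier (ultraproduct U L)"
  obtains r where "\<And>C i. C \<in> S \<Longrightarrow> r C i \<in> carrier (L i)"
    and "\<And>C. C \<in> S \<Longrightarrow> C = ultra_rel U L `` {r C}"
proof -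
  have "\<forall>C\<in>S. \<exists>f. (\<forall>i. f i \<in> carrier (L i)) \<and> C = ultra_rel U L `` {f}"
    using assms ultraproduct_carrier_iff by blast
  then show ?thesis
    using that by (metis (no_types, lifting))
qed

text \<open>The needed instance of the theorem of Los, by hand: if \<open>m i\<close> failed to be
  the meet in almost all factors, a choice of offending lower bounds would define a lower bound of
  \<open>S\<close> in the ultraproduct not below the class of \<open>m\<close>.\<close>

lemma ultraproduct_is_glb_imp:
  assumes U: "ultrafilter U" and S: "finite S"
    and r: "\<And>C i. C \<in> S \<Longrightarrow> r C i \<in> carrier (L i)"
      "\<And>C. C \<in> S \<Longrightarrow> C = ultra_rel U L `` {r C}"
    and m: "\<And>i. m i \<in> carrier (L i)"
    and glb: "is_glb (ultraproduct U L) (ultra_rel U L `` {m}) S"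
  shows "\<forall>\<^sub>F i in U. is_glb (L i) (m i) ((\<lambda>C. r C i) ` S)"
proof (rule ccontr)
  assume "\<not> ?thesis"
  then have not_glb: "\<forall>\<^sub>F i in U. \<not> is_glb (L i) (m i) ((\<lambda>C. r C i) ` S)"
    by (rule ultrafilter_eventually_not[OF U])
  have car: "S \<subseteq> carrier (ultraproduct U L)"
  proof
    fix C assume C: "C \<in> S"
    show "C \<in> carrier (ultraproduct U L)"
      by (subst r(2)[OF C], rule ultraproduct_classI, rule r(1)[OF C])
  qed
  have "\<forall>\<^sub>F i in U. m i \<sqsubseteq>\<^bsub>L i\<^esub> r C i" if "C \<in> S" for C
  proof -
    have "ultra_rel U L `` {m} \<sqsubseteq>\<^bsub>ultraproduct U L\<^esub> C"
      using glb that car unfolding greatest_def Lower_def by blast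
    with r(2)[OF that] show ?thesis
      using ultraproduct_le_iff[of m L "r C" U] m r(1)[OF that] by metis
  qed
  then have lower: "\<forall>\<^sub>F i in U. \<forall>C\<in>S. m i \<sqsubseteq>\<^bsub>L i\<^esub> r C i"
    using S by (simp add: eventually_ball_finite)
  define bad where "bad i l \<longleftrightarrow> (\<forall>C\<in>S. l \<sqsubseteq>\<^bsub>L i\<^esub> r C i) \<and> \<not> l \<sqsubseteq>\<^bsub>L i\<^esub> m i" for i l
  \<comment> \<open>\<open>l\<close> picks a lower bound not below \<open>m i\<close> wherever one
    exists; elsewhere \<open>m i\<close> serves as default, so that \<open>l\<close> always takes
    values in the carriers.\<close>
  have "\<forall>i. \<exists>l. l \<in> carrier (L i) \<and> ((\<exists>l'\<in>carrier (L i). bad i l') \<longrightarrow> bad i l)"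
    using m by blast
  then obtain l where l: "\<And>i. l i \<in> carrier (L i)"
      and bad: "\<And>i. \<exists>l'\<in>carrier (L i). bad i l' \<Longrightarrow> bad i (l i)"
    by metis
  from lower not_glb have ev': "\<forall>\<^sub>F i in U. bad i (l i)"
  proof eventually_elim
    case (elim i)
    then obtain l' where "l' \<in> Lower (L i) ((\<lambda>C. r C i) ` S)" "\<not> l' \<sqsubseteq>\<^bsub>L i\<^esub> m i"
      using m[of i] r(1) by (auto simp: greatest_def Lower_def)
    then have "l' \<in> carrier (L i)" "bad i l'"
      using r(1) by (auto simp: Lower_def bad_def)
    then show ?case
      using bad by blast
  qed
  have "ultra_rel U L `` {l} \<sqsubseteq>\<^bsub>ultraproduct U L\<^esub> C" if "C \<in> S" for C
  proof -
    from ev' have "\<forall>\<^sub>F i in U. l i \<sqsubseteq>\<^bsub>L i\<^esub> r C i"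
      by eventually_elim (use that in \<open>simp add: bad_def\<close>)
    then show ?thesis
      using ultraproduct_le_iff[of l L "r C" U] l r(1)[OF that] r(2)[OF that] by metis
  qed
  then have "ultra_rel U L `` {l} \<sqsubseteq>\<^bsub>ultraproduct U L\<^esub> ultra_rel U L `` {m}"
    using glb ultraproduct_classI[of l L U, OF l] by (auto simp: greatest_def Lower_def)
  then have "\<forall>\<^sub>F i in U. l i \<sqsubseteq>\<^bsub>L i\<^esub> m i"
    using ultraproduct_le_iff[of l L m U] l m by metis
  with ev' have "\<forall>\<^sub>F i in U. False"
    by eventually_elim (simp add: bad_def)
  with U show False
    by (simp add: ultrafilter_def)
qed

text \<open>The classes depend only on the carriers, so reversing every factor reverses the
  ultraproduct. By this duality the statement on joins follows from the one on meets.\<close>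

lemma ultraproduct_inv_gorder:
  "ultraproduct U (\<lambda>i. inv_gorder (L i)) = inv_gorder (ultraproduct U L)"
proof -
  have "ultra_rel U (\<lambda>i. inv_gorder (L i)) = ultra_rel U L"
    by (simp add: ultra_rel_def)
  then show ?thesis
    by (auto simp: ultraproduct_def fun_eq_iff)
qed

lemma is_glb_inv_gorder: "is_glb (inv_gorder L) m S \<longleftrightarrow> is_lub L m S"
  by (simp add: greatest_def least_def Lower_def Upper_def)

lemma ultraproduct_is_lub_imp:
  assumes "ultrafilter U" and "finite T"
    and "\<And>C i. C \<in> T \<Longrightarrow> r C i \<in> carrier (L i)"
      "\<And>C. C \<in> T \<Longrightarrow> C = ultra_rel U L `` {r C}"
    and "\<And>i. j i \<in> carrier (L i)"
    and "is_lub (ultraproduct U L) (ultra_rel U L `` {j}) T"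
  shows "\<forall>\<^sub>F i in U. is_lub (L i) (j i) ((\<lambda>C. r C i) ` T)"
proof -
  have rel: "ultra_rel U (\<lambda>i. inv_gorder (L i)) = ultra_rel U L"
    by (simp add: ultra_rel_def)
  show ?thesis
    using ultraproduct_is_glb_imp[of U T r "\<lambda>i. inv_gorder (L i)" j] assms
    by (simp add: rel ultraproduct_inv_gorder is_glb_inv_gorder)
qed

text \<open>The elements of \<open>\<Union>\<^sub>n \<Prod>\<^sub>U B n\<close>: the bound \<open>n\<close> may not depend on the index \<open>i\<close>.\<close>

definition ultra_union :: "'i filter \<Rightarrow> (nat \<Rightarrow> 'i \<Rightarrow> 'a set) \<Rightarrow> ('i \<Rightarrow> 'a) set set"
  where "ultra_union U B = {C. \<exists>f\<in>C. \<exists>n. \<forall>\<^sub>F i in U. f i \<in> B n i}"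

lemma ultra_union_iff:
  assumes "\<And>i. f i \<in> carrier (L i)"
  shows "ultra_rel U L `` {f} \<in> ultra_union U B \<longleftrightarrow> (\<exists>n. \<forall>\<^sub>F i in U. f i \<in> B n i)"
proof
  assume "ultra_rel U L `` {f} \<in> ultra_union U B"
  then obtain g n where "\<forall>\<^sub>F i in U. f i = g i" "\<forall>\<^sub>F i in U. g i \<in> B n i"
    by (auto simp: ultra_union_def ultra_rel_def)
  then have "\<forall>\<^sub>F i in U. f i \<in> B n i"
    by eventually_elim simp
  then show "\<exists>n. \<forall>\<^sub>F i in U. f i \<in> B n i" ..
next
  assume "\<exists>n. \<forall>\<^sub>F i in U. f i \<in> B n i"
  moreover have "f \<in> ultra_rel U L `` {f}"
    using assms by (auto simp: ultra_rel_def)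
  ultimately show "ultra_rel U L `` {f} \<in> ultra_union U B"
    by (auto simp: ultra_union_def)
qed

text \<open>A finite set of members lies in one common stage, so its meet appears one stage later. A
  join in stage \<open>n\<close> has, in almost every factor, a joinand in the same stage. The
  exceptional factors may depend on \<open>n\<close>.\<close>

lemma prime_filter_ultra_union:
  assumes U: "ultrafilter U"
    and mono: "\<And>n n' i. n \<le> n' \<Longrightarrow> B n i \<subseteq> B n' i"
    and up: "\<And>n i a b. a \<in> B n i \<Longrightarrow> b \<in> carrier (L i) \<Longrightarrow> a \<sqsubseteq>\<^bsub>L i\<^esub> b \<Longrightarrow> b \<in> B n i"
    and glb: "\<And>n. \<forall>\<^sub>F i in U. \<forall>S m. S \<subseteq> carrier (L i) \<and> S \<subseteq> B n i \<and> is_glb (L i) m S \<longrightarrow> m \<in> B (Suc n) i"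
    and lub: "\<And>n. \<forall>\<^sub>F i in U. \<forall>T j. T \<subseteq> carrier (L i) \<and> j \<in> B n i \<and> is_lub (L i) j T \<longrightarrow> T \<inter> B n i \<noteq> {}"
  shows "prime_filter (ultraproduct U L) (ultra_union U B)"
  unfolding prime_filter_def
proof (intro conjI allI impI; elim conjE)
  fix S M assume S: "finite S" "S \<subseteq> carrier (ultraproduct U L)"
    and M: "is_glb (ultraproduct U L) M S"
  obtain r where r: "\<And>C i. C \<in> S \<Longrightarrow> r C i \<in> carrier (L i)"
      "\<And>C. C \<in> S \<Longrightarrow> C = ultra_rel U L `` {r C}"
    using ultraproduct_representatives[OF S(2)] by blast
  have "M \<in> carrier (ultraproduct U L)"
    using M by (auto simp: greatest_def Lower_def)
  then obtain m where m: "\<And>i. m i \<in> carrier (L i)" "M = ultra_rel U L `` {m}"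
    by (auto simp: ultraproduct_carrier_iff)
  have glb_i: "\<forall>\<^sub>F i in U. is_glb (L i) (m i) ((\<lambda>C. r C i) ` S)"
    using ultraproduct_is_glb_imp[OF U S(1) r m(1)] M m(2) by blast
  have in_iff: "C \<in> ultra_union U B \<longleftrightarrow> (\<exists>n. \<forall>\<^sub>F i in U. r C i \<in> B n i)" if "C \<in> S" for C
    using ultra_union_iff[of "r C" L U B] r(1)[OF that] r(2)[OF that] by metis
  have M_iff: "M \<in> ultra_union U B \<longleftrightarrow> (\<exists>n. \<forall>\<^sub>F i in U. m i \<in> B n i)"
    using ultra_union_iff[of m L U B] m by metis
  show "M \<in> ultra_union U B \<longleftrightarrow> S \<subseteq> ultra_union U B"
  proof
    assume "M \<in> ultra_union U B"
    then obtain n where n: "\<forall>\<^sub>F i in U. m i \<in> B n i"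
      using M_iff by blast
    show "S \<subseteq> ultra_union U B"
    proof
      fix C assume C: "C \<in> S"
      from n glb_i have "\<forall>\<^sub>F i in U. r C i \<in> B n i"
      proof eventually_elim
        case (elim i)
        then have "m i \<sqsubseteq>\<^bsub>L i\<^esub> r C i"
          using C r(1)[OF C] by (auto simp: greatest_def Lower_def)
        with elim r(1)[OF C] show ?case
          using up by blast
      qed
      then show "C \<in> ultra_union U B"
        using in_iff[OF C] by blast
    qed
  next
    assume "S \<subseteq> ultra_union U B"
    then have "\<forall>C\<in>S. \<exists>n. \<forall>\<^sub>F i in U. r C i \<in> B n i"
      using in_iff by blast
    then obtain k where k: "\<forall>C\<in>S. \<forall>\<^sub>F i in U. r C i \<in> B (k C) i"
      by metis
    \<comment> \<open>A common stage for all of \<open>S\<close>; inserting 0 keeps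
      \<open>Max\<close> meaningful for empty \<open>S\<close>.\<close>
    define n where "n = Max (insert 0 (k ` S))"
    have kn: "k C \<le> n" if "C \<in> S" for C
      using S(1) that by (auto simp: n_def)
    have "\<forall>\<^sub>F i in U. \<forall>C\<in>S. r C i \<in> B (k C) i"
      using S(1) k by (simp add: eventually_ball_finite)
    then have "\<forall>\<^sub>F i in U. m i \<in> B (Suc n) i"
      using glb_i glb[of n]
    proof eventually_elim
      case (elim i)
      have "(\<lambda>C. r C i) ` S \<subseteq> B n i"
        using elim(1) mono[OF kn] by blast
      moreover have "(\<lambda>C. r C i) ` S \<subseteq> carrier (L i)"
        using r(1) by blast
      ultimately show ?case
        using elim(2,3) by blast
    qed
    then show "M \<in> ultra_union U B"
      using M_iff by blast
  qed
next
  fix T J assume T: "finite T" "T \<subseteq> carrier (ultraproduct U L)"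
    and J: "is_lub (ultraproduct U L) J T"
  obtain r where r: "\<And>C i. C \<in> T \<Longrightarrow> r C i \<in> carrier (L i)"
      "\<And>C. C \<in> T \<Longrightarrow> C = ultra_rel U L `` {r C}"
    using ultraproduct_representatives[OF T(2)] by blast
  have "J \<in> carrier (ultraproduct U L)"
    using J by (auto simp: least_def Upper_def)
  then obtain j where j: "\<And>i. j i \<in> carrier (L i)" "J = ultra_rel U L `` {j}"
    by (auto simp: ultraproduct_carrier_iff)
  have lub_i: "\<forall>\<^sub>F i in U. is_lub (L i) (j i) ((\<lambda>C. r C i) ` T)"
    using ultraproduct_is_lub_imp[OF U T(1) r j(1)] J j(2) by blast
  have in_iff: "C \<in> ultra_union U B \<longleftrightarrow> (\<exists>n. \<forall>\<^sub>F i in U. r C i \<in> B n i)" if "C \<in> T" for C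
    using ultra_union_iff[of "r C" L U B] r(1)[OF that] r(2)[OF that] by metis
  have J_iff: "J \<in> ultra_union U B \<longleftrightarrow> (\<exists>n. \<forall>\<^sub>F i in U. j i \<in> B n i)"
    using ultra_union_iff[of j L U B] j by metis
  show "J \<in> ultra_union U B \<longleftrightarrow> T \<inter> ultra_union U B \<noteq> {}"
  proof
    assume "J \<in> ultra_union U B"
    then obtain n where "\<forall>\<^sub>F i in U. j i \<in> B n i"
      using J_iff by blast
    then have "\<forall>\<^sub>F i in U. \<exists>C\<in>T. r C i \<in> B n i"
      using lub_i lub[of n]
    proof eventually_elim
      case (elim i)
      moreover have "(\<lambda>C. r C i) ` T \<subseteq> carrier (L i)"
        using r(1) by blast
      ultimately have "(\<lambda>C. r C i) ` T \<inter> B n i \<noteq> {}"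
        by blast
      then show ?case
        by blast
    qed
    \<comment> \<open>The joinand found so far depends on \<open>i\<close>; finiteness of
      \<open>T\<close> fixes a single one.\<close>
    then obtain C where "C \<in> T" "\<forall>\<^sub>F i in U. r C i \<in> B n i"
      using ultrafilter_eventually_bex_finite[OF U T(1), of "\<lambda>C i. r C i \<in> B n i"] by blast
    then show "T \<inter> ultra_union U B \<noteq> {}"
      using in_iff by blast
  next
    assume "T \<inter> ultra_union U B \<noteq> {}"
    then obtain C n where C: "C \<in> T" "\<forall>\<^sub>F i in U. r C i \<in> B n i"
      using in_iff by blast
    from C(2) lub_i have "\<forall>\<^sub>F i in U. j i \<in> B n i"
    proof eventually_elim
      case (elim i)
      then have "r C i \<sqsubseteq>\<^bsub>L i\<^esub> j i"
        using C(1) r(1)[OF C(1)] by (auto simp: least_def Upper_def)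
      with elim j(1) show ?case
        using up by blast
    qed
    then show "J \<in> ultra_union U B"
      using J_iff by blast
  qed
qed


section \<open>The posets \<open>P\<^sub>k\<close>\<close>

lemma Nn_unique_level: "x \<in> Nn m \<Longrightarrow> x \<in> Nn n \<Longrightarrow> m = n"
proof (induction m arbitrary: x n)
  case 0
  then show ?case by (cases n) auto
next
  case (Suc m)
  obtain n' where n': "n = Suc n'"
    using Suc.prems by (cases n) auto
  then obtain y z where "y \<in> Nn m" "x = NE (Upair y z)" "y \<in> Nn n'"
    using Suc.prems by auto
  then show ?case
    using Suc.IH n' by blast
qed

text \<open>The three edges of a triangle are again three distinct nodes, one level up.\<close>

lemma Nn_three_distinct: "\<exists>x\<in>Nn n. \<exists>y\<in>Nn n. \<exists>z\<in>Nn n. x \<noteq> y \<and> x \<noteq> z \<and> y \<noteq> z"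
proof (induction n)
  case 0
  then show ?case by auto
next
  case (Suc n)
  then obtain x y z where xyz: "x \<in> Nn n" "y \<in> Nn n" "z \<in> Nn n" "x \<noteq> y" "x \<noteq> z" "y \<noteq> z"
    by blast
  then have "NE (Upair x y) \<in> Nn (Suc n)" "NE (Upair x z) \<in> Nn (Suc n)" "NE (Upair y z) \<in> Nn (Suc n)"
    by (auto simp del: Upair_inject)
  with xyz show ?case
    by (metis Upair_inject node.inject)
qed

lemma Nn_ex_other: "\<exists>y\<in>Nn n. y \<noteq> x"
  using Nn_three_distinct[of n] by metis

text \<open>Twins have the same elements strictly below them; this keeps either from being the join
  of a set not containing it.\<close>

lemma P_less_Pr2_iff_Pr1: "P_less k u (Pr2 x) \<longleftrightarrow> P_less k u (Pr1 x)"
  by (auto elim!: P_less.cases intro: P_less.intros)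

lemma P_less_p_iff: "P_less k u Elt_p \<longleftrightarrow> u \<in> Nd ` Nn 0"
  by (auto elim!: P_less.cases intro: P_less.intros)

text \<open>Since \<open>Upair\<close> is symmetric, \<open>x\<close> may be taken as the first end
  of the edge. The index is shifted to the level of the ends, hence \<open>n < k\<close>.\<close>

lemma P_less_Pr1_cases:
  assumes "P_less k u (Pr1 x)"
  obtains n where "n \<le> k" "x \<in> Nn n" "u = Nd x"
  | n y where "n < k" "x \<in> Nn n" "y \<in> Nn n" "x \<noteq> y" "u = Nd (NE (Upair x y))"
  | "x \<in> Nn k" "u = Elt_q"
  using assms
proof cases
  case (3 n x' y')
  then have "n - 1 < k" by auto
  with 3 show ?thesis
    using that(2)[of "n - 1" y'] that(2)[of "n - 1" x'] by auto
qed (use that in auto)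

lemma P_less_lower: "P_less k u v \<Longrightarrow> u = Elt_q \<or> (\<exists>x. u = Nd x)"
  by (auto elim: P_less.cases)

lemma P_less_upper: "P_less k u v \<Longrightarrow> v = Elt_p \<or> (\<exists>x. v \<in> {Pr1 x, Pr2 x})"
  by (auto elim: P_less.cases)

section \<open>Meets and joins in \<open>Pk k\<close> that lie outside their set\<close>

lemma Pk_le_iff: "a \<sqsubseteq>\<^bsub>Pk k\<^esub> b \<longleftrightarrow> P_less k a b \<or> a = b"
  by (simp add: Pk_def)

lemma Pk_carrier_simps [simp]:
  "Elt_p \<in> carrier (Pk k)" "Elt_q \<in> carrier (Pk k)"
  "Nd x \<in> carrier (Pk k) \<longleftrightarrow> (\<exists>n\<le>k. x \<in> Nn n)"
  "Pr1 x \<in> carrier (Pk k) \<longleftrightarrow> (\<exists>n\<le>k. x \<in> Nn n)"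
  "Pr2 x \<in> carrier (Pk k) \<longleftrightarrow> (\<exists>n\<le>k. x \<in> Nn n)"
  by (auto simp: Pk_def Nhat_def)

text \<open>The order has height two: \<open>Elt_q\<close> and the nodes are never strictly above
  anything, while \<open>Elt_p\<close> and the twins are never strictly below anything.\<close>

lemma not_P_less_trans: "P_less k a b \<Longrightarrow> \<not> P_less k c a"
  using P_less_lower P_less_upper by blast

text \<open>An empty meet would be a greatest element, above both \<open>Elt_p\<close> and
  \<open>Elt_q\<close>. By height two no lower bound is strictly below \<open>m\<close>, so
  \<open>m\<close> is the only common strict lower bound.\<close>

lemma Pk_is_glb_proper:
  assumes glb: "is_glb (Pk k) m S" and S: "S \<subseteq> carrier (Pk k)" and m: "m \<notin> S"
  shows "S \<noteq> {}" and "\<And>s. s \<in> S \<Longrightarrow> P_less k m s"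
    and "\<And>l. l \<in> carrier (Pk k) \<Longrightarrow> (\<And>s. s \<in> S \<Longrightarrow> P_less k l s) \<Longrightarrow> l = m"
proof -
  have greatest: "P_less k l m \<or> l = m"
    if "l \<in> carrier (Pk k)" "\<And>s. s \<in> S \<Longrightarrow> P_less k l s" for l
  proof -
    have "l \<in> Lower (Pk k) S"
      using that by (auto simp: Lower_def Pk_le_iff)
    then have "l \<sqsubseteq>\<^bsub>Pk k\<^esub> m"
      using glb by (auto simp: greatest_def)
    then show ?thesis
      by (simp add: Pk_le_iff)
  qed
  show lower: "P_less k m s" if "s \<in> S" for s
  proof -
    have "m \<sqsubseteq>\<^bsub>Pk k\<^esub> s"
      using glb that S by (auto simp: greatest_def Lower_def)
    then show ?thesis
      using m that by (auto simp: Pk_le_iff)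
  qed
  show "S \<noteq> {}"
  proof
    assume "S = {}"
    then have "P_less k Elt_p m \<or> Elt_p = m" "P_less k Elt_q m \<or> Elt_q = m"
      using greatest by simp_all
    then show False
      by (auto elim: P_less.cases)
  qed
  then show "l = m" if "l \<in> carrier (Pk k)" "\<And>s. s \<in> S \<Longrightarrow> P_less k l s" for l
    using greatest[OF that] lower not_P_less_trans by blast
qed

text \<open>Dually, \<open>j\<close> is the only common strict upper bound. A twin is excluded
  because its partner would be another one, which leaves \<open>Elt_p\<close>. A single base node
  \<open>x\<close> lies below its own twins as well, so \<open>T\<close> needs two base
  nodes.\<close>

lemma Pk_is_lub_proper:
  assumes lub: "is_lub (Pk k) j T" and T: "T \<subseteq> carrier (Pk k)" and j: "j \<notin> T"
  shows "j = Elt_p" and "T \<subseteq> Nd ` Nn 0" and "\<not> T \<subseteq> {Nd x}"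
proof -
  have jk: "j \<in> carrier (Pk k)"
    using lub by (auto simp: least_def Upper_def)
  have least: "P_less k j l \<or> j = l"
    if "l \<in> carrier (Pk k)" "\<And>t. t \<in> T \<Longrightarrow> P_less k t l" for l
  proof -
    have "l \<in> Upper (Pk k) T"
      using that by (auto simp: Upper_def Pk_le_iff)
    then have "j \<sqsubseteq>\<^bsub>Pk k\<^esub> l"
      using lub by (auto simp: least_def)
    then show ?thesis
      by (simp add: Pk_le_iff)
  qed
  have upper: "P_less k t j" if "t \<in> T" for t
  proof -
    have "t \<sqsubseteq>\<^bsub>Pk k\<^esub> j"
      using lub that T by (auto simp: least_def Upper_def)
    then show ?thesis
      using j that by (auto simp: Pk_le_iff)
  qed
  have "T \<noteq> {}"
  proof
    assume "T = {}"
    then have "P_less k j Elt_p \<or> j = Elt_p" "P_less k j Elt_q \<or> j = Elt_q"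
      using least by simp_all
    then show False
      by (auto elim: P_less.cases)
  qed
  with upper have least': "j = l"
    if "l \<in> carrier (Pk k)" "\<And>t. t \<in> T \<Longrightarrow> P_less k t l" for l
    using least[OF that] not_P_less_trans by blast
  show p: "j = Elt_p"
  proof (rule ccontr)
    assume "j \<noteq> Elt_p"
    then obtain x where x: "j \<in> {Pr1 x, Pr2 x}"
      using \<open>T \<noteq> {}\<close> upper P_less_upper by blast
    with jk have "Pr1 x \<in> carrier (Pk k)" "Pr2 x \<in> carrier (Pk k)"
      by auto
    moreover have "P_less k t (Pr1 x)" "P_less k t (Pr2 x)" if "t \<in> T" for t
      using upper[OF that] x by (auto simp: P_less_Pr2_iff_Pr1)
    ultimately have "j = Pr1 x" "j = Pr2 x"
      using least' by blast+
    then show False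
      by simp
  qed
  show T0: "T \<subseteq> Nd ` Nn 0"
    using upper p P_less_p_iff by blast
  show "\<not> T \<subseteq> {Nd x}"
  proof
    assume "T \<subseteq> {Nd x}"
    with \<open>T \<noteq> {}\<close> have T_eq: "T = {Nd x}"
      by blast
    with T0 have "x \<in> Nn 0"
      by blast
    then have "Pr1 x \<in> carrier (Pk k)" "P_less k (Nd x) (Pr1 x)"
      using P_less.intros(2)[of 0 k x "Pr1 x"] by (auto simp del: Nn.simps)
    then have "j = Pr1 x"
      using least' T_eq by blast
    with p show False
      by simp
  qed
qed

section \<open>The nodes generated by the base nodes other than \<open>y\<close>\<close>

fun N_avoid :: "node \<Rightarrow> nat \<Rightarrow> node set" where
  "N_avoid y 0 = Nn 0 - {y}"
| "N_avoid y (Suc n) = {NE (Upair x z) | x z. x \<in> N_avoid y n \<and> z \<in> N_avoid y n \<and> x \<noteq> z}"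

text \<open>Stage \<open>n\<close> of the closure process. It does not mention \<open>k\<close>, so
  the same stages serve in all factors.\<close>

definition G_avoid :: "node \<Rightarrow> nat \<Rightarrow> elt set"
  where "G_avoid y n = insert Elt_p (\<Union>r\<le>n. Nd ` N_avoid y r \<union> Pr1 ` N_avoid y r \<union> Pr2 ` N_avoid y r)"

lemma G_avoid_simps [simp]:
  "Elt_p \<in> G_avoid y n" "Elt_q \<notin> G_avoid y n"
  "Nd x \<in> G_avoid y n \<longleftrightarrow> (\<exists>r\<le>n. x \<in> N_avoid y r)"
  "Pr1 x \<in> G_avoid y n \<longleftrightarrow> (\<exists>r\<le>n. x \<in> N_avoid y r)"
  "Pr2 x \<in> G_avoid y n \<longleftrightarrow> (\<exists>r\<le>n. x \<in> N_avoid y r)"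
  by (auto simp: G_avoid_def)

lemma G_avoid_mono: "n \<le> n' \<Longrightarrow> G_avoid y n \<subseteq> G_avoid y n'"
  by (fastforce simp: G_avoid_def)

lemma N_avoid_subset_Nn: "N_avoid y n \<subseteq> Nn n"
  by (induction n) auto

lemma N_avoid_base: "x \<in> N_avoid y r \<Longrightarrow> x \<in> Nn 0 \<Longrightarrow> x \<in> Nn 0 - {y}"
  by (cases r) auto

lemma edge_in_N_avoid:
  assumes "NE (Upair x z) \<in> N_avoid y r"
  shows "\<exists>r'<r. x \<in> N_avoid y r' \<and> z \<in> N_avoid y r'"
proof (cases r)
  case 0
  with assms show ?thesis by auto
next
  case (Suc r')
  with assms show ?thesis by auto
qed

text \<open>Above an edge lie only its own twins and those of its ends, and the ends belong to an
  earlier level. Thus going up, unlike taking meets, stays in the same stage.\<close>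

lemma G_avoid_upward_closed:
  assumes "a \<in> G_avoid y n" "P_less k a b"
  shows "b \<in> G_avoid y n"
  using assms(2,1)
proof cases
  case (3 n' x z)
  with assms(1) obtain r where "r \<le> n" "NE (Upair x z) \<in> N_avoid y r"
    by auto
  then obtain r' where "r' \<le> n" "x \<in> N_avoid y r'" "z \<in> N_avoid y r'"
    using edge_in_N_avoid[of x z y r] by (meson less_imp_le order_trans)
  with 3 show ?thesis
    by auto
qed (use assms(1) in auto)

text \<open>If \<open>m\<close> is not in \<open>S\<close>, it lies strictly below all of
  \<open>S\<close>. With \<open>Elt_p\<close> in \<open>S\<close> it is a base node, shown to differ
  from \<open>y\<close>. Otherwise \<open>S\<close> contains twins of two distinct nodes
  \<open>x\<close> and \<open>z\<close>, so \<open>m\<close> is \<open>x\<close>, \<open>z\<close>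
  or the edge between them. \<open>Elt_q\<close> is excluded because it is only below twins of level
  \<open>k\<close>, and \<open>n < k\<close>.\<close>

lemma G_avoid_glb:
  assumes n: "n < k" and y: "y \<in> Nn 0"
    and S: "S \<subseteq> carrier (Pk k)" "S \<subseteq> G_avoid y n" and glb: "is_glb (Pk k) m S"
  shows "m \<in> G_avoid y (Suc n)"
proof (cases "m \<in> S")
  case True
  then show ?thesis
    using S(2) G_avoid_mono[of n "Suc n" y] by auto
next
  case False
  note proper = Pk_is_glb_proper[OF glb S(1) False]
  have prime: "\<exists>x r. s \<in> {Pr1 x, Pr2 x} \<and> P_less k m (Pr1 x) \<and> r \<le> n \<and> x \<in> N_avoid y r"
    if s: "s \<in> S" "s \<noteq> Elt_p" for s
  proof -
    obtain x where x: "s \<in> {Pr1 x, Pr2 x}"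
      using P_less_upper[OF proper(2)[OF s(1)]] s(2) by blast
    moreover have "P_less k m (Pr1 x)"
      using proper(2)[OF s(1)] x by (auto simp: P_less_Pr2_iff_Pr1)
    moreover have "\<exists>r\<le>n. x \<in> N_avoid y r"
      using x S(2) s(1) by auto
    ultimately show ?thesis
      by blast
  qed
  show ?thesis
  proof (cases "Elt_p \<in> S")
    case p: True
    then obtain z where z: "z \<in> Nn 0" "m = Nd z"
      using proper(2) P_less_p_iff by blast
    have "z \<noteq> y"
    proof
      assume "z = y"
      have "S \<subseteq> {Elt_p}"
      proof (rule ccontr)
        assume "\<not> S \<subseteq> {Elt_p}"
        then obtain s where "s \<in> S" "s \<noteq> Elt_p"
          by blast
        then obtain x r where x: "P_less k m (Pr1 x)" "x \<in> N_avoid y r"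
          using prime by blast
        \<comment> \<open>A base node is not an edge, so the only twins above \<open>y\<close> are
          its own, and these are in no stage.\<close>
        from x(1) have "x = y"
          by (cases rule: P_less_Pr1_cases) (use z \<open>z = y\<close> in auto)
        then show False
          using x(2) y N_avoid_base by blast
      qed
      \<comment> \<open>Now \<open>Elt_p\<close> itself is a lower bound of \<open>S\<close>, hence
        would have to be below \<open>y\<close>.\<close>
      then have "P_less k Elt_p s \<or> Elt_p = s" if "s \<in> S" for s
        using that by auto
      then have "Elt_p \<in> Lower (Pk k) S"
        by (auto simp: Lower_def Pk_le_iff)
      then have "Elt_p \<sqsubseteq>\<^bsub>Pk k\<^esub> m"
        using glb by (auto simp: greatest_def)
      then show False
        using z by (auto simp: Pk_le_iff elim: P_less.cases)
    qed
    then have "z \<in> N_avoid y 0"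
      using z by simp
    then show ?thesis
      using z(2) G_avoid_simps(3) by blast
  next
    case no_p: False
    obtain s where s: "s \<in> S"
      using proper(1) by blast
    then obtain x r where x: "s \<in> {Pr1 x, Pr2 x}" "P_less k m (Pr1 x)" "r \<le> n" "x \<in> N_avoid y r"
      using prime no_p by metis
    have xr: "x \<in> Nn r"
      using x(4) N_avoid_subset_Nn by blast
    \<comment> \<open>Any second node of the level of \<open>x\<close> will do: \<open>x\<close> and
      its edge to \<open>w\<close> are both below both twins of \<open>x\<close>, so a set of twins
      of \<open>x\<close> alone has no unique strict lower bound. The edge is in \<open>Pk k\<close>
      because \<open>Suc r \<le> k\<close>.\<close>
    obtain w where w: "w \<in> Nn r" "w \<noteq> x"
      using Nn_ex_other by blast
    have "\<not> S \<subseteq> {Pr1 x, Pr2 x}"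
    proof
      assume sub: "S \<subseteq> {Pr1 x, Pr2 x}"
      have rk: "r \<le> k" "Suc r \<le> k"
        using x(3) n by auto
      have e: "NE (Upair x w) \<in> Nn (Suc r)"
        using xr w by (auto simp del: Upair_inject)
      have "P_less k (Nd x) t" "P_less k (Nd (NE (Upair x w))) t" if "t \<in> S" for t
        using sub that rk xr w P_less.intros(2)[of r k x t]
          P_less.intros(3)[of "Suc r" k x w t] by auto
      moreover have "Nd x \<in> carrier (Pk k)" "Nd (NE (Upair x w)) \<in> carrier (Pk k)"
        using rk xr e unfolding Pk_carrier_simps by blast+
      ultimately have "Nd x = m" "Nd (NE (Upair x w)) = m"
        using proper(3) by blast+
      then have "x \<in> Nn (Suc r)"
        using e by (metis elt.inject(1))
      then show False
        using Nn_unique_level[OF xr] n_not_Suc_n by blast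
    qed
    then obtain s' where s': "s' \<in> S" "s' \<notin> {Pr1 x, Pr2 x}"
      by blast
    then obtain z r' where z: "s' \<in> {Pr1 z, Pr2 z}" "P_less k m (Pr1 z)" "r' \<le> n" "z \<in> N_avoid y r'"
      using prime no_p by metis
    have xz: "x \<noteq> z"
      using s'(2) z(1) by blast
    have zr: "z \<in> Nn r'"
      using z(4) N_avoid_subset_Nn by blast
    from x(2) show ?thesis
    proof (cases rule: P_less_Pr1_cases)
      case 1
      then show ?thesis
        using x(3,4) by (auto intro: le_SucI)
    next
      case 3
      then show ?thesis
        using Nn_unique_level[OF xr 3(1)] x(3) n by simp
    next
      case (2 l v)
      note x_edge = 2
      from z(2) show ?thesis
      proof (cases rule: P_less_Pr1_cases)
        case 1
        then show ?thesis
          using z(3,4) by (auto intro: le_SucI)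
      next
        case 3
        then show ?thesis
          using Nn_unique_level[OF zr 3(1)] z(3) n by simp
      next
        case (2 l' v')
        \<comment> \<open>The same edge \<open>m\<close> has \<open>x\<close> and \<open>z\<close>
          among its ends, so it joins them.\<close>
        then have "v = z"
          using x_edge xz by auto
        moreover have "l = r" "l = r'"
          using x_edge(2,3) \<open>v = z\<close> xr zr Nn_unique_level by blast+
        ultimately have "NE (Upair x z) \<in> N_avoid y (Suc r)"
          using x(4) z(4) xz by auto
        then show ?thesis
          using x_edge(5) \<open>v = z\<close> x(3) G_avoid_simps(3) Suc_le_mono by blast
      qed
    qed
  qed
qed

text \<open>A set with a join outside it contains two base nodes, one of which differs from
  \<open>y\<close> and is in stage 0.\<close>

lemma G_avoid_lub:
  assumes "T \<subseteq> carrier (Pk k)" "j \<in> G_avoid y n" "is_lub (Pk k) j T"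
  shows "T \<inter> G_avoid y n \<noteq> {}"
proof (cases "j \<in> T")
  case True
  with assms(2) show ?thesis by blast
next
  case False
  note proper = Pk_is_lub_proper[OF assms(3,1) False]
  obtain t where t: "t \<in> T" "t \<noteq> Nd y"
    using proper(3)[of y] by blast
  then obtain x where "x \<in> N_avoid y 0" "t = Nd x"
    using proper(2) by (auto simp del: Nn.simps)
  then have "t \<in> G_avoid y n"
    using G_avoid_simps(3) le0 by blast
  with t show ?thesis by blast
qed


section \<open>Separating points of the ultraproduct\<close>

abbreviation up_set :: "(nat \<Rightarrow> elt) \<Rightarrow> nat \<Rightarrow> elt set"
  where "up_set u i \<equiv> {x. u i \<sqsubseteq>\<^bsub>Pk i\<^esub> x}"

text \<open>A constant chain suffices, as an up-set absorbs meets at once. The hypothesis on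
  \<open>u\<close> keeps \<open>Elt_p\<close>, the only possible join outside its set, out of
  \<open>up_set u i\<close>.\<close>

lemma prime_filter_up_set:
  assumes "ultrafilter U" and UC: "\<And>i. u i \<in> carrier (Pk i)"
    and u: "\<forall>\<^sub>F i in U. u i \<notin> insert Elt_p (Nd ` Nn 0)"
  shows "prime_filter (ultraproduct U Pk) (ultra_union U (\<lambda>_. up_set u))"
proof (rule prime_filter_ultra_union)
  show "b \<in> up_set u i"
    if "a \<in> up_set u i" "b \<in> carrier (Pk i)" "a \<sqsubseteq>\<^bsub>Pk i\<^esub> b" for i a b
    using that not_P_less_trans by (auto simp: Pk_le_iff)
  fix n
  show "\<forall>\<^sub>F i in U. \<forall>S m. S \<subseteq> carrier (Pk i) \<and> S \<subseteq> up_set u i \<and> is_glb (Pk i) m S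
      \<longrightarrow> m \<in> up_set u i"
    using UC by (intro always_eventually) (fastforce simp: greatest_def Lower_def)
  show "\<forall>\<^sub>F i in U. \<forall>T j. T \<subseteq> carrier (Pk i) \<and> j \<in> up_set u i \<and> is_lub (Pk i) j T
      \<longrightarrow> T \<inter> up_set u i \<noteq> {}"
    using u
  proof (eventually_elim, intro allI impI, elim conjE)
    fix i T j assume ui: "u i \<notin> insert Elt_p (Nd ` Nn 0)"
      and T: "T \<subseteq> carrier (Pk i)" "j \<in> up_set u i" "is_lub (Pk i) j T"
    have "j \<in> T"
    proof (rule ccontr)
      assume "j \<notin> T"
      then have "j = Elt_p"
        using Pk_is_lub_proper(1) T by blast
      with T(2) ui show False
        using P_less_p_iff by (auto simp: Pk_le_iff simp del: Nn.simps)
    qed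
    with T(2) show "T \<inter> up_set u i \<noteq> {}"
      by blast
  qed
qed (use assms in auto)

text \<open>Stage \<open>n\<close> obeys the meet law in the factors with \<open>n < i\<close>.
  These are almost all, since \<open>U\<close> is nonprincipal.\<close>

lemma prime_filter_G_avoid:
  assumes "ultrafilter U" "nonprincipal U" and y: "y \<in> Nn 0"
  shows "prime_filter (ultraproduct U Pk) (ultra_union U (\<lambda>n i. G_avoid y n))"
proof (rule prime_filter_ultra_union)
  show "b \<in> G_avoid y n" if "a \<in> G_avoid y n" "a \<sqsubseteq>\<^bsub>Pk i\<^esub> b" for n i a b
    using that G_avoid_upward_closed by (auto simp: Pk_le_iff)
  fix n
  have "\<forall>\<^sub>F i in U. i \<notin> {..n}"
    using nonprincipal_eventually_notin_finite[OF assms(1,2)] by blast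
  then show "\<forall>\<^sub>F i in U. \<forall>S m. S \<subseteq> carrier (Pk i) \<and> S \<subseteq> G_avoid y n \<and> is_glb (Pk i) m S
      \<longrightarrow> m \<in> G_avoid y (Suc n)"
    by eventually_elim (metis G_avoid_glb y atMost_iff not_le)
  show "\<forall>\<^sub>F i in U. \<forall>T j. T \<subseteq> carrier (Pk i) \<and> j \<in> G_avoid y n \<and> is_lub (Pk i) j T
      \<longrightarrow> T \<inter> G_avoid y n \<noteq> {}"
    using G_avoid_lub by (intro always_eventually) blast
qed (use assms G_avoid_mono in auto)

lemma separate_of_up_set:
  assumes U: "ultrafilter U"
    and u: "\<And>i. u i \<in> carrier (Pk i)" "\<not> (\<forall>\<^sub>F i in U. u i \<in> insert Elt_p (Nd ` Nn 0))"
    and v: "\<And>i. v i \<in> carrier (Pk i)" "\<not> (\<forall>\<^sub>F i in U. u i \<sqsubseteq>\<^bsub>Pk i\<^esub> v i)"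
  shows "\<exists>G. prime_filter (ultraproduct U Pk) G \<and>
    ultra_rel U Pk `` {u} \<in> G \<and> ultra_rel U Pk `` {v} \<notin> G"
proof (intro exI conjI)
  show "prime_filter (ultraproduct U Pk) (ultra_union U (\<lambda>_. up_set u))"
    using prime_filter_up_set[OF U u(1)] ultrafilter_eventually_not[OF U u(2)] by blast
  show "ultra_rel U Pk `` {u} \<in> ultra_union U (\<lambda>_. up_set u)"
    using ultra_union_iff[of u Pk U] u(1) by (simp add: Pk_le_iff)
  show "ultra_rel U Pk `` {v} \<notin> ultra_union U (\<lambda>_. up_set u)"
    using ultra_union_iff[of v Pk U] v by simp
qed

text \<open>Stage 0 already contains \<open>v\<close>, whereas no stage ever reaches
  \<open>Nd y\<close>.\<close>

lemma separate_of_G_avoid: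
  assumes U: "ultrafilter U" "nonprincipal U"
    and u: "\<And>i. u i \<in> carrier (Pk i)" "\<forall>\<^sub>F i in U. u i = Nd y" and y: "y \<in> Nn 0"
    and v: "\<And>i. v i \<in> carrier (Pk i)" "\<forall>\<^sub>F i in U. v i \<in> insert Elt_p (Nd ` Nn 0) - {Nd y}"
  shows "\<exists>G. prime_filter (ultraproduct U Pk) G \<and>
    ultra_rel U Pk `` {v} \<in> G \<and> ultra_rel U Pk `` {u} \<notin> G"
proof (intro exI conjI)
  let ?G = "ultra_union U (\<lambda>n i. G_avoid y n)"
  show "prime_filter (ultraproduct U Pk) ?G"
    by (rule prime_filter_G_avoid[OF U y])
  have sub: "insert Elt_p (Nd ` Nn 0) - {Nd y} \<subseteq> G_avoid y 0"
    by (auto simp del: Nn.simps)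
  from v(2) have "\<forall>\<^sub>F i in U. v i \<in> G_avoid y 0"
    by eventually_elim (rule subsetD[OF sub])
  then show "ultra_rel U Pk `` {v} \<in> ?G"
    using ultra_union_iff[of v Pk U] v(1) by blast
  have "Nd y \<notin> G_avoid y n" for n
    using N_avoid_base[of y y] y by auto
  have "\<not> (\<forall>\<^sub>F i in U. u i \<in> G_avoid y n)" for n
  proof
    assume "\<forall>\<^sub>F i in U. u i \<in> G_avoid y n"
    with u(2) have "\<forall>\<^sub>F i in U. False"
      by eventually_elim (use \<open>Nd y \<notin> G_avoid y n\<close> in simp)
    with U(1) show False
      by (simp add: ultrafilter_def)
  qed
  then show "ultra_rel U Pk `` {u} \<notin> ?G"
    by (simp add: ultra_union_iff u(1))
qed

theorem proposition3p11:
  fixes U :: "nat filter"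
  assumes "ultrafilter U" and "nonprincipal U"
  shows "representable natLeq natLeq (ultraproduct U Pk)"
proof (rule representable_if_prime_filters_separate)
  fix C D assume "C \<in> carrier (ultraproduct U Pk)" "D \<in> carrier (ultraproduct U Pk)" "C \<noteq> D"
  then obtain u v where u: "\<And>i. u i \<in> carrier (Pk i)" "C = ultra_rel U Pk `` {u}"
      and v: "\<And>i. v i \<in> carrier (Pk i)" "D = ultra_rel U Pk `` {v}"
    by (auto simp: ultraproduct_carrier_iff)
  \<comment> \<open>\<open>?Z\<close> is the principal down-set of \<open>Elt_p\<close>: for
    elements outside it, up-sets serve as prime filters.\<close>
  let ?Z = "insert Elt_p (Nd ` Nn 0)"
  have ne: "\<not> (\<forall>\<^sub>F i in U. u i = v i)"
  proof
    assume "\<forall>\<^sub>F i in U. u i = v i"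
    then have "(u, v) \<in> ultra_rel U Pk"
      using u v by (simp add: ultra_rel_def)
    then show False
      using \<open>C \<noteq> D\<close> u v equiv_class_eq[OF equiv_ultra_rel] by blast
  qed
  have antisym: False if "\<forall>\<^sub>F i in U. u i \<sqsubseteq>\<^bsub>Pk i\<^esub> v i" "\<forall>\<^sub>F i in U. v i \<sqsubseteq>\<^bsub>Pk i\<^esub> u i"
  proof -
    from that have "\<forall>\<^sub>F i in U. u i = v i"
      by eventually_elim (auto simp: Pk_le_iff dest: not_P_less_trans)
    with ne show False ..
  qed
  have down: "\<forall>\<^sub>F i in U. f i \<in> ?Z"
    if "\<forall>\<^sub>F i in U. f i \<sqsubseteq>\<^bsub>Pk i\<^esub> g i" "\<forall>\<^sub>F i in U. g i \<in> ?Z" for f g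
    using that
  proof eventually_elim
    case (elim i)
    then show ?case
      using P_less_p_iff P_less_upper[of i "f i" "g i"] by (auto simp: Pk_le_iff simp del: Nn.simps)
  qed
  \<comment> \<open>If neither of the first two cases holds, then by \<open>antisym\<close> one of
    \<open>u\<close> and \<open>v\<close> is almost everywhere in \<open>?Z\<close>. The other is in
    \<open>?Z\<close> too, or is below it and hence in \<open>?Z\<close> by
    \<open>down\<close>.\<close>
  consider "\<not> (\<forall>\<^sub>F i in U. u i \<in> ?Z)" "\<not> (\<forall>\<^sub>F i in U. u i \<sqsubseteq>\<^bsub>Pk i\<^esub> v i)"
    | "\<not> (\<forall>\<^sub>F i in U. v i \<in> ?Z)" "\<not> (\<forall>\<^sub>F i in U. v i \<sqsubseteq>\<^bsub>Pk i\<^esub> u i)"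
    | "\<forall>\<^sub>F i in U. u i \<in> ?Z" "\<forall>\<^sub>F i in U. v i \<in> ?Z"
    using antisym down by metis
  then show "\<exists>G. prime_filter (ultraproduct U Pk) G \<and> (C \<in> G \<longleftrightarrow> D \<notin> G)"
  proof cases
    case 1
    then show ?thesis
      using separate_of_up_set[OF assms(1) u(1) _ v(1)] u(2) v(2) by blast
  next
    case 2
    then show ?thesis
      using separate_of_up_set[OF assms(1) v(1) _ u(1)] u(2) v(2) by blast
  next
    case 3
    \<comment> \<open>\<open>?Z\<close> is finite and the same in all factors, so a function into it
      is constant on a large set.\<close>
    have const: "\<exists>a\<in>?Z. \<forall>\<^sub>F i in U. f i = a" if "\<forall>\<^sub>F i in U. f i \<in> ?Z" for f
      using ultrafilter_eventually_bex_finite[OF assms(1), of ?Z "\<lambda>a i. f i = a"] that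
      by (simp add: finite_N del: Nn.simps)
    obtain a where a: "a \<in> ?Z" "\<forall>\<^sub>F i in U. u i = a"
      using const[OF 3(1)] by blast
    obtain b where b: "b \<in> ?Z" "\<forall>\<^sub>F i in U. v i = b"
      using const[OF 3(2)] by blast
    have "a \<noteq> b"
    proof
      assume "a = b"
      from a(2) b(2) have "\<forall>\<^sub>F i in U. u i = v i"
        by eventually_elim (simp add: \<open>a = b\<close>)
      with ne show False ..
    qed
    \<comment> \<open>At most one of \<open>a\<close> and \<open>b\<close> is \<open>Elt_p\<close>;
      the other is a base node, which becomes the node to avoid.\<close>
    then consider y where "y \<in> Nn 0" "a = Nd y" "b \<in> ?Z - {Nd y}"
      | y where "y \<in> Nn 0" "b = Nd y" "a \<in> ?Z - {Nd y}"
      using a(1) b(1) by blast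
    then show ?thesis
    proof cases
      case (1 y)
      have "\<forall>\<^sub>F i in U. v i \<in> ?Z - {Nd y}"
        using b(2) by eventually_elim (use 1 in simp)
      then show ?thesis
        using separate_of_G_avoid[OF assms u(1) _ 1(1) v(1)] a(2) 1(2) u(2) v(2) by blast
    next
      case (2 y)
      have "\<forall>\<^sub>F i in U. u i \<in> ?Z - {Nd y}"
        using a(2) by eventually_elim (use 2 in simp)
      then show ?thesis
        using separate_of_G_avoid[OF assms v(1) _ 2(1) u(1)] b(2) 2(2) u(2) v(2) by blast
    qed
  qed
qed

end
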